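(* Let $\mathbf X=(X_1,\dots,X_j)$ be a random vector with joint density $f_{\mathbf X}$ over $\mathbb R^j$, all of whose absolute multivariate moments exist, and let $h_1,\dots,h_j>0$. For nonnegative integers $t_1,\dots,t_j$ put $$m_{t_1\ldots t_j}=\int_{\mathbb R^j}x_1^{t_1}\cdots x_j^{t_j}f_{\mathbf X}(\mathbf x)\,d\mathbf x,$$ $$\tilde m_{t_1\ldots t_j}=\frac1{h_1\cdots h_j}\int_{R_j}\int_{\mathbb R^j}(x_1+z_1)^{t_1}\cdots(x_j+z_j)^{t_j}f_{\mathbf X}(\mathbf x)\,d\mathbf x\,d\mathbf z,$$ where $R_j=\{\mathbf z\in\mathbb R^j: z_k\in(-\tfrac12h_k,\tfrac12h_k)\ \forall k\in\{1,\dots,j\}\}$. Suppose that the sequence $\{m_{t_1\ldots t_j}\}$ is umbrally represented by the umbral monomial $\mu_M$ (i.e. $E[\mu_1^{t_1}\cdots\mu_j^{t_j}]=m_{t_1\ldots t_j}$ for all $t_1,\dots,t_j\geq 0$) and the sequence $\{\tilde m_{t_1\ldots t_j}\}$ is umbrally represented by the umbral monomial $\tilde\mu_M$ (i.e. $E[\tilde\mu_1^{t_1}\cdots\tilde\mu_j^{t_j}]=\tilde m_{t_1\ldots t_j}$ for all $t_1,\dots,t_j\geq 0$). Then, for all nonnegative integers $t_1,\dots,t_j$, $$\tilde\mu_M\equiv\left[\mu+h\left(-1\boldsymbol{.}\iota-\tfrac12\right)\right]_M,\qquad\text{where}\qquad \left[\mu+h\left(-1\boldsymbol{.}\iota-\tfrac12\right)\right]_M=\prod_{k=1}^j\left[\mu_k+h_k\left(-1\boldsymbol{.}\iota_k-\tfrac12\right)\right]^{t_k}$$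 and $\iota_1,\dots,\iota_j$ are uncorrelated Bernoulli umbrae.
   Context: Classical umbral calculus: there is an alphabet $A$ of symbols called umbrae, the polynomial ring $\mathcal R=\mathbb R[x]$, and a linear functional $E:\mathcal R[A]\to\mathcal R$ (evaluation) with $E[1]=1$ and $E[x^n\alpha^i\beta^l\cdots\gamma^k]=x^nE[\alpha^i]E[\beta^l]\cdots E[\gamma^k]$ for any distinct umbrae $\alpha,\beta,\dots,\gamma\in A$ and nonnegative integers $n,i,l,\dots,k$. The support of an umbral polynomial is the set of umbrae occurring in it; umbral polynomials with disjoint supports are called uncorrelated. There is an umbra $\varepsilon\in A$ (augmentation) with $E[\varepsilon^n]=\delta_{0,n}$. For umbral polynomials $p,q\in\mathcal R[A]$, $p\simeq q$ means $E[p]=E[q]$, and $p\equiv q$ (similarity) means $p^n\simeq q^n$ for all integers $n\ge 0$. The inverse $-1\boldsymbol{.}\gamma$ of an umbra $\gamma$ is an umbra uncorrelated with $\gamma$ such that $\gamma+(-1\boldsymbol{.}\gamma)\equiv\varepsilon$ (unique up to similarity). A Bernoulli umbra is an umbra $\iota$ with $E[\iota^n]=B_n$ for all $n\ge0$, where $\{B_n\}$ are the Bernoulli numbers, $\sum_{n\ge0}B_nt^n/n!=t/(e^t-1)$ (so $B_1=-1/2$). Multisets: $M$ is a multiset with finite support $\{\mu_1,\dots,\mu_j\}$ of umbral monomials (not necessarily uncorrelated with each other), $t_k$ is the multiplicity of $\mu_k$ in $M$, and $\mu_M=\prod_{k=1}^j\mu_k^{t_k}$; likewise $\tilde\mu_M=\prod_{k=1}^j\tilde\mu_k^{t_k}$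 for umbral monomials $\tilde\mu_1,\dots,\tilde\mu_j$. The umbrae $\iota_1,\dots,\iota_j$ and their inverses $-1\boldsymbol{.}\iota_1,\dots,-1\boldsymbol{.}\iota_j$ are all mutually uncorrelated and uncorrelated with $\mu_1,\dots,\mu_j$. *)

theory Defs
  imports
    "HOL-Probability.Probability"
    "HOL-Library.Poly_Mapping"
    "HOL-Computational_Algebra.Computational_Algebra"
begin

text \<open>
  The alphabet is a type \<open>'a\<close> of umbrae. An umbral polynomial is a finitely supported map from
  power products of umbrae (exponent maps \<open>'a \<Rightarrow>\<^sub>0 nat\<close>) to coefficients in
  \<open>\<real>[x]\<close>, with the convolution product of \<^theory>\<open>HOL-Library.Poly_Mapping\<close>.
\<close>

type_synonym 'a upoly = "('a \<Rightarrow>\<^sub>0 nat) \<Rightarrow>\<^sub>0 real poly"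

definition ucoeff :: "real poly \<Rightarrow> 'a upoly"
  where "ucoeff c = Poly_Mapping.single 0 c"

abbreviation uconst :: "real \<Rightarrow> 'a upoly"
  where "uconst r \<equiv> ucoeff [:r:]"

definition umbra :: "'a \<Rightarrow> 'a upoly"
  where "umbra a = Poly_Mapping.single (Poly_Mapping.single a 1) 1"

text \<open>A monomial may carry a coefficient from \<open>\<real>[x]\<close>; pure power products are the case
  \<open>c = 1\<close>.\<close>

definition umbral_monomial :: "'a upoly \<Rightarrow> bool"
  where "umbral_monomial p \<longleftrightarrow> (\<exists>c u. p = Poly_Mapping.single u c)"

definition usupp :: "'a upoly \<Rightarrow> 'a set"
  where "usupp p = (\<Union>u\<in>Poly_Mapping.keys p. Poly_Mapping.keys u)"

definition uncorrelated :: "'a upoly \<Rightarrow> 'a upoly \<Rightarrow> bool"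
  where "uncorrelated p q \<longleftrightarrow> usupp p \<inter> usupp q = {}"

locale umbral_calculus =
  fixes E :: "'a upoly \<Rightarrow> real poly"
    and aug :: 'a  \<comment> \<open>the augmentation umbra\<close>
  assumes E_add: "E (p + q) = E p + E q"
    and E_scale: "E (uconst r * p) = smult r (E p)"
    and E_one: "E 1 = 1"
    and E_prod: "finite S \<Longrightarrow>
      E (ucoeff (monom 1 n) * (\<Prod>a\<in>S. umbra a ^ i a)) = monom 1 n * (\<Prod>a\<in>S. E (umbra a ^ i a))"
    and E_aug: "E (umbra aug ^ n) = (if n = 0 then 1 else 0)"

definition umbrally_equiv :: "('a upoly \<Rightarrow> real poly) \<Rightarrow> 'a upoly \<Rightarrow> 'a upoly \<Rightarrow> bool"
  where "umbrally_equiv E p q \<longleftrightarrow> E p = E q"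

definition similar :: "('a upoly \<Rightarrow> real poly) \<Rightarrow> 'a upoly \<Rightarrow> 'a upoly \<Rightarrow> bool"
  where "similar E p q \<longleftrightarrow> (\<forall>n::nat. umbrally_equiv E (p ^ n) (q ^ n))"

text \<open>\<open>b\<close> is an inverse \<open>-1.a\<close> of the umbra \<open>a\<close>; it is determined only up to similarity.\<close>

definition inverse_umbra :: "('a upoly \<Rightarrow> real poly) \<Rightarrow> 'a \<Rightarrow> 'a \<Rightarrow> 'a \<Rightarrow> bool"
  where "inverse_umbra E aug a b \<longleftrightarrow>
    uncorrelated (umbra a) (umbra b) \<and> similar E (umbra a + umbra b) (umbra aug)"

text \<open>The exponential generating function \<open>t / (exp t - 1)\<close>, divided as formal power series.\<close>

definition bernoulli_number :: "nat \<Rightarrow> real"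
  where "bernoulli_number n = fact n * fps_nth (fps_X / (fps_exp 1 - 1)) n"

lemma bernoulli_number_egf:
  "Abs_fps (\<lambda>n. bernoulli_number n / fact n) * (fps_exp 1 - 1) = fps_X"
proof -
  have nz: "fps_exp (1::real) - 1 \<noteq> 0"
  proof
    assume "fps_exp (1::real) - 1 = 0"
    then have "fps_nth (fps_exp (1::real) - 1) 1 = 0" by simp
    then show False by simp
  qed
  have sub: "subdegree (fps_exp (1::real) - 1) = 1"
    by (rule subdegreeI) auto
  have eq: "Abs_fps (\<lambda>n. bernoulli_number n / fact n) = fps_X / (fps_exp 1 - 1)"
    by (rule fps_ext) (simp add: bernoulli_number_def)
  have "(fps_exp (1::real) - 1) dvd fps_X"
    using nz sub by (simp add: fps_dvd_iff)
  then show ?thesis unfolding eq by simp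
qed

definition bernoulli_umbra :: "('a upoly \<Rightarrow> real poly) \<Rightarrow> 'a \<Rightarrow> bool"
  where "bernoulli_umbra E a \<longleftrightarrow> (\<forall>n. E (umbra a ^ n) = [:bernoulli_number n:])"

definition raw_moment :: "(real ^ 'n \<Rightarrow> real) \<Rightarrow> ('n \<Rightarrow> nat) \<Rightarrow> real"
  where "raw_moment f t = (LINT x|lborel. (\<Prod>k\<in>UNIV. x $ k ^ t k) * f x)"

definition grouping_box :: "('n \<Rightarrow> real) \<Rightarrow> (real ^ 'n) set"
  where "grouping_box h = {z. \<forall>k. z $ k \<in> {- (1/2) * h k <..< (1/2) * h k}}"

definition grouped_moment :: "('n \<Rightarrow> real) \<Rightarrow> (real ^ 'n \<Rightarrow> real) \<Rightarrow> ('n \<Rightarrow> nat) \<Rightarrow> real"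
  where "grouped_moment h f t =
    1 / (\<Prod>k\<in>UNIV. h k) *
    (LINT z:grouping_box h|lborel. (LINT x|lborel. (\<Prod>k\<in>UNIV. (x $ k + z $ k) ^ t k) * f x))"

end

theory Submission
  imports Defs
begin

text \<open>Grouping adds to \<open>X\<close> an independent rounding error that is uniform on the box, and the umbra
  \<open>-1.\<iota> - 1/2\<close> has exactly the moments of the uniform distribution on \<open>(-1/2, 1/2)\<close>: the Bernoulli
  numbers have exponential generating function \<open>t / (e\<^sup>t - 1)\<close>, so an inverse umbra has
  \<open>(e\<^sup>t - 1) / t\<close>, which is the moment generating function of the uniform distribution on \<open>(0, 1)\<close>, and
  subtracting \<open>1/2\<close> centres it. Scaling by \<open>h\<^sub>k\<close> gives the error in the \<open>k\<close>-th coordinate, and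
  uncorrelated umbrae play the role of independent coordinates.

  Both sides are therefore expanded by the binomial theorem in every coordinate and compared term by
  term. On the umbral side (\<open>E_prod_shifted_expansion\<close>) each term splits because evaluation is
  multiplicative on umbral polynomials with disjoint supports (\<open>E_mult_uncorrelated\<close>), and the moments of
  the error are given by \<open>shifted_inverse_bernoulli_moment\<close>. On the analytic side
  (\<open>grouped_moment_expansion\<close>) the inner integral yields raw moments of \<open>X\<close>, and the outer one
  integrates a monomial over a box, hence is a product of one-dimensional integrals
  (\<open>set_integral_grouping_box\<close>).

  Similarity asks for equal evaluations of all powers, but the \<open>n\<close>-th power of either side is the same
  expression with exponents \<open>n t\<^sub>k\<close>, so equality of evaluations for every exponent vector is enough.\<close>

section \<open>Umbral polynomials as sums of monomials\<close>

lemma poly_mapping_as_sum_single: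
  fixes p :: "'b \<Rightarrow>\<^sub>0 'c::comm_monoid_add"
  shows "p = (\<Sum>u\<in>Poly_Mapping.keys p. Poly_Mapping.single u (Poly_Mapping.lookup p u))"
  by (rule poly_mapping_eqI)
    (simp add: lookup_sum lookup_single when_def in_keys_iff sum.delta)

lemma umbra_power: "umbra a ^ n = Poly_Mapping.single (Poly_Mapping.single a n) 1"
  by (induction n) (simp_all add: umbra_def mult_single single_add[symmetric])

text \<open>This puts a monomial into the form to which the product axiom of evaluation applies.\<close>

lemma single_as_product:
  "Poly_Mapping.single u c =
    ucoeff c * (\<Prod>a\<in>Poly_Mapping.keys u. umbra a ^ Poly_Mapping.lookup u a)"
proof -
  have prod_single: "(\<Prod>a\<in>S. Poly_Mapping.single (w a) (1::real poly)) =
      Poly_Mapping.single (\<Sum>a\<in>S. w a) 1" for S :: "'a set" and w :: "'a \<Rightarrow> 'a \<Rightarrow>\<^sub>0 nat"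
    by (induction S rule: infinite_finite_induct) (simp_all add: mult_single)
  show ?thesis
    by (simp add: umbra_power prod_single poly_mapping_as_sum_single[symmetric] ucoeff_def mult_single)
qed

lemma ucoeff_simps:
  "ucoeff 0 = 0" "ucoeff 1 = 1" "ucoeff (c + d) = ucoeff c + ucoeff d"
  "ucoeff (c * d) = ucoeff c * ucoeff d" "ucoeff (- c) = - ucoeff c"
  by (simp_all add: ucoeff_def single_add mult_single single_uminus)

section \<open>Supports\<close>

lemma usupp_add: "usupp (p + q) \<subseteq> usupp p \<union> usupp q"
  using keys_add[of p q] unfolding usupp_def by blast

lemma usupp_mult: "usupp (p * q) \<subseteq> usupp p \<union> usupp q"
proof
  fix a assume "a \<in> usupp (p * q)"
  then obtain w where w: "w \<in> Poly_Mapping.keys (p * q)" "a \<in> Poly_Mapping.keys w"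
    by (auto simp: usupp_def)
  then obtain u v where "w = u + v" "u \<in> Poly_Mapping.keys p" "v \<in> Poly_Mapping.keys q"
    using keys_mult[of p q] by blast
  then show "a \<in> usupp p \<union> usupp q"
    using w(2) keys_add[of u v] by (auto simp: usupp_def)
qed

lemma usupp_ucoeff [simp]: "usupp (ucoeff c) = {}"
  by (simp add: usupp_def ucoeff_def)

lemma usupp_one [simp]: "usupp 1 = {}"
  using usupp_ucoeff[of 1] by (simp add: ucoeff_simps)

lemma usupp_umbra [simp]: "usupp (umbra a) = {a}"
  by (simp add: usupp_def umbra_def)

lemma usupp_power: "usupp (p ^ n) \<subseteq> usupp p"
  by (induction n) (use usupp_mult in force)+

lemma usupp_prod: "usupp (\<Prod>k\<in>S. p k) \<subseteq> (\<Union>k\<in>S. usupp (p k))"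
  by (induction S rule: infinite_finite_induct) (use usupp_mult in force)+

section \<open>Evaluation of uncorrelated products\<close>

context umbral_calculus
begin

lemma E_zero: "E 0 = 0"
  using E_add[of 0 0] by simp

lemma E_sum: "E (\<Sum>k\<in>S. p k) = (\<Sum>k\<in>S. E (p k))"
  by (induction S rule: infinite_finite_induct) (simp_all add: E_zero E_add)

lemma E_of_nat_mult: "E (of_nat n * p) = of_nat n * E p"
  by (induction n) (simp_all add: E_zero E_add distrib_right)

text \<open>The product axiom covers only the coefficients \<open>x\<^sup>n\<close>; real linearity carries it over to every
  coefficient polynomial.\<close>

lemma E_single:
  "E (Poly_Mapping.single u c) =
    c * (\<Prod>a\<in>Poly_Mapping.keys u. E (umbra a ^ Poly_Mapping.lookup u a))"
proof -
  define q where "q = (\<Prod>a\<in>Poly_Mapping.keys u. umbra a ^ Poly_Mapping.lookup u a)"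
  define e where "e = (\<Prod>a\<in>Poly_Mapping.keys u. E (umbra a ^ Poly_Mapping.lookup u a))"
  \<comment> \<open>Each coefficient is split off as a real scalar, which evaluation passes through.\<close>
  have "c = (\<Sum>i\<le>degree c. [:coeff c i:] * monom 1 i)"
    by (simp add: smult_monom poly_as_sum_of_monoms)
  then obtain S :: "nat set" and r where c: "c = (\<Sum>i\<in>S. [:r i:] * monom 1 i)"
    by blast
  have ucoeff_sum: "ucoeff (\<Sum>i\<in>S. d i) = (\<Sum>i\<in>S. ucoeff (d i))" for d :: "nat \<Rightarrow> real poly"
    by (induction S rule: infinite_finite_induct) (simp_all add: ucoeff_simps)
  have "E (ucoeff c * q) = (\<Sum>i\<in>S. E (uconst (r i) * (ucoeff (monom 1 i) * q)))"
    unfolding c ucoeff_sum sum_distrib_right E_sum ucoeff_simps mult.assoc ..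
  also have "\<dots> = (\<Sum>i\<in>S. [:r i:] * monom 1 i * e)"
    unfolding E_scale q_def e_def by (simp add: E_prod)
  also have "\<dots> = c * e"
    by (simp add: c sum_distrib_right)
  finally show ?thesis
    unfolding single_as_product[of u c] q_def e_def .
qed

lemma E_ucoeff: "E (ucoeff c) = c"
  by (simp add: ucoeff_def E_single)

text \<open>By bilinearity it suffices to treat two monomials. If their supports are disjoint, the exponent map of
  their product restricts to the given exponents on each support, so the product over its keys splits.\<close>

lemma E_mult_uncorrelated:
  assumes "uncorrelated p q"
  shows "E (p * q) = E p * E q"
proof -
  let ?K = Poly_Mapping.keys and ?L = Poly_Mapping.lookup and ?s = Poly_Mapping.single
  have monomials: "E (?s u c * ?s v d) = E (?s u c) * E (?s v d)"
    if "?K u \<inter> ?K v = {}" for u v c d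
  proof -
    have disjoint: "?L u a = 0 \<or> ?L v a = 0" for a
      using that by (auto simp: in_keys_iff)
    have K: "?K (u + v) = ?K u \<union> ?K v"
      by (auto simp: in_keys_iff lookup_add)
    have u: "(\<Prod>a\<in>?K u. E (umbra a ^ ?L (u + v) a)) = (\<Prod>a\<in>?K u. E (umbra a ^ ?L u a))"
    proof (intro prod.cong refl)
      fix a assume "a \<in> ?K u"
      then show "E (umbra a ^ ?L (u + v) a) = E (umbra a ^ ?L u a)"
        using disjoint[of a] by (simp add: in_keys_iff lookup_add)
    qed
    have v: "(\<Prod>a\<in>?K v. E (umbra a ^ ?L (u + v) a)) = (\<Prod>a\<in>?K v. E (umbra a ^ ?L v a))"
    proof (intro prod.cong refl)
      fix a assume "a \<in> ?K v"
      then show "E (umbra a ^ ?L (u + v) a) = E (umbra a ^ ?L v a)"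
        using disjoint[of a] by (simp add: in_keys_iff lookup_add)
    qed
    show ?thesis
      using that by (simp add: mult_single E_single K prod.union_disjoint u v)
  qed
  have "E (p * q) = E ((\<Sum>u\<in>?K p. ?s u (?L p u)) * (\<Sum>v\<in>?K q. ?s v (?L q v)))"
    by (simp only: poly_mapping_as_sum_single[symmetric])
  also have "\<dots> = (\<Sum>u\<in>?K p. \<Sum>v\<in>?K q. E (?s u (?L p u)) * E (?s v (?L q v)))"
    unfolding sum_product E_sum
    using assms by (intro sum.cong refl monomials) (auto simp: uncorrelated_def usupp_def)
  also have "\<dots> = E (\<Sum>u\<in>?K p. ?s u (?L p u)) * E (\<Sum>v\<in>?K q. ?s v (?L q v))"
    by (simp add: sum_product E_sum)
  finally show ?thesis
    by (simp only: poly_mapping_as_sum_single[symmetric])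
qed

lemma E_ucoeff_mult: "E (ucoeff c * p) = c * E p"
  by (simp add: E_mult_uncorrelated uncorrelated_def E_ucoeff)

lemma E_prod_uncorrelated:
  assumes "finite S"
    and "\<And>k l. k \<in> S \<Longrightarrow> l \<in> S \<Longrightarrow> k \<noteq> l \<Longrightarrow> uncorrelated (p k) (p l)"
  shows "E (\<Prod>k\<in>S. p k) = (\<Prod>k\<in>S. E (p k))"
  using assms
proof (induction S rule: finite_induct)
  case (insert k S)
  have "uncorrelated (p k) (\<Prod>l\<in>S. p l)"
    using insert.prems insert.hyps usupp_prod[of p S] by (fastforce simp: uncorrelated_def)
  then show ?case
    using insert by (simp add: E_mult_uncorrelated)
qed (simp add: E_one)

section \<open>Moments of the inverse Bernoulli umbra\<close>

lemma E_binomial_uncorrelated: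
  assumes "uncorrelated p q"
  shows "E ((p + q) ^ n) = (\<Sum>k\<le>n. of_nat (n choose k) * (E (p ^ k) * E (q ^ (n - k))))"
proof -
  have "uncorrelated (p ^ k) (q ^ l)" for k l
    using assms usupp_power[of p k] usupp_power[of q l] by (auto simp: uncorrelated_def)
  then show ?thesis
    by (simp add: binomial_ring E_sum E_of_nat_mult E_mult_uncorrelated mult.assoc)
qed

end

text \<open>The coefficient of \<open>t\<^sup>n\<^sup>+\<^sup>1\<close> in \<open>(t / (e\<^sup>t - 1)) (e\<^sup>t - 1) = t\<close>, multiplied by \<open>n!\<close>. It says that
  the numbers \<open>1 / (n + 1)\<close> are the binomial convolution inverse of the Bernoulli numbers.\<close>

lemma bernoulli_number_recurrence:
  "(\<Sum>k\<le>n. real (n choose k) * bernoulli_number k / real (n - k + 1)) = (if n = 0 then 1 else 0)"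
proof -
  have "fps_nth (Abs_fps (\<lambda>n. bernoulli_number n / fact n) * (fps_exp 1 - 1)) (Suc n) =
      (\<Sum>k\<le>n. bernoulli_number k / fact k * (1 / fact (Suc n - k)))"
    unfolding fps_mult_nth by (simp add: atLeast0AtMost mult.commute)
  then have "(\<Sum>k\<le>n. bernoulli_number k / fact k * (1 / fact (Suc n - k))) = (if n = 0 then 1 else 0)"
    by (simp add: bernoulli_number_egf)
  then have "fact n * (\<Sum>k\<le>n. bernoulli_number k / fact k * (1 / fact (Suc n - k))) =
      (if n = 0 then 1 else 0)"
    by simp
  moreover have "fact n * (bernoulli_number k / fact k * (1 / fact (Suc n - k))) =
      real (n choose k) * bernoulli_number k / real (n - k + 1)" if "k \<le> n" for k
    using that by (simp add: binomial_fact Suc_diff_le field_simps)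
  ultimately show ?thesis
    by (simp add: sum_distrib_left)
qed

context umbral_calculus
begin

text \<open>The moments of \<open>b\<close> and the numbers \<open>1 / (n + 1)\<close> satisfy the same recurrence: their binomial
  convolution with the Bernoulli numbers is the moment sequence of the augmentation. The recurrence has
  only one solution because \<open>B\<^sub>0 = 1\<close>, so that its term with index \<open>0\<close> determines the \<open>n\<close>-th unknown
  from the earlier ones.\<close>

lemma inverse_bernoulli_moment:
  assumes "bernoulli_umbra E a" and "inverse_umbra E aug a b"
  shows "E (umbra b ^ n) = [:1 / real (n + 1):]"
proof (induction n rule: less_induct)
  case (less n)
  have a: "E (umbra a ^ k) = [:bernoulli_number k:]" for k
    using assms(1) by (simp add: bernoulli_umbra_def)
  have a0: "bernoulli_number 0 = 1"
    using bernoulli_number_recurrence[of 0] by simp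
  have "E ((umbra a + umbra b) ^ n) = (if n = 0 then 1 else 0)"
    using assms(2) by (simp add: inverse_umbra_def similar_def umbrally_equiv_def E_aug)
  moreover have "E ((umbra a + umbra b) ^ n) =
      (\<Sum>k\<le>n. of_nat (n choose k) * ([:bernoulli_number k:] * E (umbra b ^ (n - k))))"
    using assms(2) by (simp add: inverse_umbra_def E_binomial_uncorrelated a)
  ultimately have "(\<Sum>k\<le>n. of_nat (n choose k) * ([:bernoulli_number k:] * E (umbra b ^ (n - k)))) =
      (if n = 0 then 1 else 0)" by simp
  moreover have "(\<Sum>k\<le>n. of_nat (n choose k) * ([:bernoulli_number k:] * [:1 / real (n - k + 1):])) =
      (if n = 0 then 1 else (0 :: real poly))"
  proof -
    have "(\<Sum>k\<le>n. of_nat (n choose k) * ([:bernoulli_number k:] * [:1 / real (n - k + 1):])) =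
        [:\<Sum>k\<le>n. real (n choose k) * bernoulli_number k / real (n - k + 1):]"
      by (simp add: of_nat_poly mult.commute flip: sum_to_poly)
    then show ?thesis
      by (simp only: bernoulli_number_recurrence) (simp add: one_pCons)
  qed
  moreover have "(\<Sum>k\<in>{..n}-{0}. of_nat (n choose k) * ([:bernoulli_number k:] * E (umbra b ^ (n - k)))) =
     (\<Sum>k\<in>{..n}-{0}. of_nat (n choose k) * ([:bernoulli_number k:] * [:1 / real (n - k + 1):]))"
    by (intro sum.cong refl) (simp add: less.IH)
  ultimately show ?case
    by (simp add: sum.remove[of "{..n}" 0] a0)
qed

text \<open>The value is \<open>\<integral> (u + r)\<^sup>n du\<close> over \<open>0 < u < 1\<close>. Algebraically,
  \<open>(n choose k) / (k + 1) = (n + 1 choose k + 1) / (n + 1)\<close> turns the binomial sum into an expansion of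
  \<open>(1 + r)\<^sup>n\<^sup>+\<^sup>1\<close> in which only the term \<open>r\<^sup>n\<^sup>+\<^sup>1\<close> is missing.\<close>

lemma shifted_inverse_bernoulli_moment:
  assumes "bernoulli_umbra E a" and "inverse_umbra E aug a b"
  shows "E ((umbra b + uconst r) ^ n) = [:((1 + r) ^ Suc n - r ^ Suc n) / real (Suc n):]"
proof -
  have uconst_power: "uconst r ^ k = uconst (r ^ k)" for k
    by (induction k) (simp_all add: ucoeff_simps flip: one_pCons, simp add: mult.commute flip: ucoeff_simps)
  have "E ((umbra b + uconst r) ^ n) =
      (\<Sum>k\<le>n. of_nat (n choose k) * ([:1 / real (k + 1):] * [:r ^ (n - k):]))"
    by (subst E_binomial_uncorrelated)
      (simp_all add: uncorrelated_def inverse_bernoulli_moment[OF assms] uconst_power E_ucoeff)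
  also have "\<dots> = [:\<Sum>k\<le>n. real (n choose k) / real (k + 1) * r ^ (n - k):]"
    by (simp add: of_nat_poly mult.commute flip: sum_to_poly)
  also have "(\<Sum>k\<le>n. real (n choose k) / real (k + 1) * r ^ (n - k)) =
      (\<Sum>k\<le>n. real (Suc n choose Suc k) * r ^ (n - k)) / real (Suc n)"
    unfolding sum_divide_distrib
  proof (rule sum.cong[OF refl])
    fix k
    have "real (Suc k) * real (Suc n choose Suc k) = real (Suc n) * real (n choose k)"
      using Suc_times_binomial_eq[of n k] by (metis mult.commute of_nat_mult)
    then have "real (n choose k) / real (k + 1) = real (Suc n choose Suc k) / real (Suc n)"
      by (simp add: field_simps del: binomial_Suc_Suc)
    then show "real (n choose k) / real (k + 1) * r ^ (n - k) =
        real (Suc n choose Suc k) * r ^ (n - k) / real (Suc n)"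
      by simp
  qed
  also have "(\<Sum>k\<le>n. real (Suc n choose Suc k) * r ^ (n - k)) = (1 + r) ^ Suc n - r ^ Suc n"
    unfolding binomial_ring[of 1 r "Suc n"] sum.atMost_Suc_shift by simp
  finally show ?thesis .
qed

end

section \<open>Integrals over the grouping box\<close>

text \<open>Lebesgue measure on a Euclidean space is by definition the image of a product measure indexed by the
  basis vectors; the proof applies Fubini there and renames basis vectors to coordinates.\<close>

lemma
  fixes g :: "'n::finite \<Rightarrow> real \<Rightarrow> real"
  assumes g: "\<And>k. integrable lborel (g k)"
  shows integrable_lborel_prod_cart: "integrable lborel (\<lambda>z::real^'n. \<Prod>k\<in>UNIV. g k (z $ k))"
    and integral_lborel_prod_cart:
      "(LINT z|lborel. (\<Prod>k\<in>UNIV. g k ((z::real^'n) $ k))) = (\<Prod>k\<in>UNIV. (LINT x|lborel. g k x))"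
proof -
  interpret product_sigma_finite "\<lambda>_::real^'n. lborel :: real measure" ..
  \<comment> \<open>Inverse of the enumeration of the basis by coordinates, used to index the factors by basis vectors.\<close>
  define ix :: "real^'n \<Rightarrow> 'n" where "ix b = (SOME k. b = axis k 1)" for b
  have ix [simp]: "ix (axis k 1) = k" for k :: 'n
    unfolding ix_def by (rule some_equality) (simp_all add: axis_eq_axis)
  have bij: "bij_betw (\<lambda>k. axis k (1::real)) (UNIV :: 'n set) Basis"
    unfolding bij_betw_def by (auto simp: inj_on_def axis_eq_axis Basis_vec_def)
  have reindex: "(\<Prod>b\<in>Basis. F (ix b) b) = (\<Prod>k\<in>UNIV. F k (axis k 1))"
    for F :: "'n \<Rightarrow> real^'n \<Rightarrow> real"
    by (simp add: prod.reindex_bij_betw[OF bij, symmetric])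
  have comp: "(\<Sum>b\<in>Basis. w b *\<^sub>R b) $ k = w (axis k 1)" for w :: "real^'n \<Rightarrow> real" and k
    by (simp only: cart_eq_inner_axis) (simp add: inner_sum_left_Basis)
  have meas [measurable]: "g k \<in> borel_measurable borel" for k
    using g[of k] by (auto dest: borel_measurable_integrable)
  note borel_measurable_nth [measurable]
  have split: "(\<Prod>k\<in>UNIV. g k ((\<Sum>b\<in>Basis. w b *\<^sub>R b) $ k)) = (\<Prod>b\<in>Basis. g (ix b) (w b))"
    for w :: "real^'n \<Rightarrow> real"
    unfolding comp by (rule reindex[of "\<lambda>k b. g k (w b)", symmetric])
  show "integrable lborel (\<lambda>z::real^'n. \<Prod>k\<in>UNIV. g k (z $ k))"
    by (subst lborel_eq, subst integrable_distr_eq)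
      (auto simp only: split intro!: product_integrable_prod g, measurable)
  have "(LINT z|lborel. (\<Prod>k\<in>UNIV. g k ((z::real^'n) $ k))) =
      (LINT w|Pi\<^sub>M Basis (\<lambda>_. lborel). (\<Prod>b\<in>Basis. g (ix b) (w b)))"
    by (subst lborel_eq, subst integral_distr) (simp_all only: split, measurable)
  also have "\<dots> = (\<Prod>b\<in>Basis. (LINT x|lborel. g (ix b) x))"
    by (rule product_integral_prod) (simp_all add: g)
  also have "\<dots> = (\<Prod>k\<in>UNIV. (LINT x|lborel. g k x))"
    by (rule reindex[of "\<lambda>k b. LINT x|lborel. g k x"])
  finally show "(LINT z|lborel. (\<Prod>k\<in>UNIV. g k ((z::real^'n) $ k))) = (\<Prod>k\<in>UNIV. (LINT x|lborel. g k x))" .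
qed

text \<open>The factor multiplying \<open>c ^ Suc n\<close> is the \<open>n\<close>-th moment of the uniform distribution on
  \<open>(-1/2, 1/2)\<close>, written as it arises from \<open>shifted_inverse_bernoulli_moment\<close> at \<open>r = -1/2\<close>.\<close>

lemma
  fixes c :: real
  assumes "c > 0"
  shows integrable_power_Ioo: "integrable lborel (\<lambda>x. indicator {- (1/2) * c <..< (1/2) * c} x * x ^ n)"
    and integral_power_Ioo: "(LINT x|lborel. indicator {- (1/2) * c <..< (1/2) * c} x * x ^ n) =
      c ^ Suc n * (((1/2) ^ Suc n - (- (1/2)) ^ Suc n) / real (Suc n))"
proof -
  let ?I = "{- (1/2) * c <..< (1/2) * c}" and ?C = "{- (1/2) * c .. (1/2) * c}"
  have "integrable lborel (\<lambda>x::real. indicator ?C x *\<^sub>R x ^ n)"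
    by (rule borel_integrable_compact) (auto intro!: continuous_intros)
  then have C: "set_integrable lborel ?C (\<lambda>x::real. x ^ n)"
    by (simp add: set_integrable_def)
  have "set_integrable lborel ?I (\<lambda>x::real. x ^ n)"
    by (rule set_integrable_subset[OF C]) auto
  then show "integrable lborel (\<lambda>x. indicator ?I x * x ^ n)"
    by (simp add: set_integrable_def)
  have "(LINT x|lborel. indicator ?I x * x ^ n) = (LINT x|lborel. x ^ n * indicator ?C x)"
    \<comment> \<open>The open and the closed interval differ only in two endpoints, a null set.\<close>
    using AE_lborel_singleton[of "- (1/2) * c"] AE_lborel_singleton[of "(1/2) * c"]
    by (intro integral_cong_AE) (measurable, auto elim!: AE_mp simp: indicator_def)
  also have "\<dots> = (((1/2) * c) ^ Suc n - (- (1/2) * c) ^ Suc n) / real (Suc n)"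
    using assms by (subst integral_power) simp_all
  also have "\<dots> = c ^ Suc n * (((1/2) ^ Suc n - (- (1/2)) ^ Suc n) / real (Suc n))"
    by (simp only: power_mult_distrib) (simp add: field_simps)
  finally show "(LINT x|lborel. indicator ?I x * x ^ n) =
      c ^ Suc n * (((1/2) ^ Suc n - (- (1/2)) ^ Suc n) / real (Suc n))" .
qed

lemma indicator_grouping_box:
  "indicator (grouping_box h) z =
    (\<Prod>k\<in>UNIV. indicator {- (1/2) * h k <..< (1/2) * h k} (z $ k) :: real)"
  by (auto simp: grouping_box_def indicator_def)

lemma
  fixes h :: "'n::finite \<Rightarrow> real" and n :: "'n \<Rightarrow> nat"
  assumes h: "\<And>k. h k > 0"
  shows set_integrable_grouping_box:
      "set_integrable lborel (grouping_box h) (\<lambda>z. \<Prod>k\<in>UNIV. z $ k ^ n k)"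
    and set_integral_grouping_box:
      "(LINT z:grouping_box h|lborel. (\<Prod>k\<in>UNIV. z $ k ^ n k)) =
        (\<Prod>k\<in>UNIV. h k ^ Suc (n k) * (((1/2) ^ Suc (n k) - (- (1/2)) ^ Suc (n k)) / real (Suc (n k))))"
proof -
  define g where "g k x = indicator {- (1/2) * h k <..< (1/2) * h k} x * x ^ n k" for k and x :: real
  have g: "integrable lborel (g k)" for k
    unfolding g_def by (rule integrable_power_Ioo[OF h])
  have box: "indicator (grouping_box h) z *\<^sub>R (\<Prod>k\<in>UNIV. z $ k ^ n k) = (\<Prod>k\<in>UNIV. g k (z $ k))" for z
    by (simp only: indicator_grouping_box g_def prod.distrib real_scaleR_def)
  show "set_integrable lborel (grouping_box h) (\<lambda>z. \<Prod>k\<in>UNIV. z $ k ^ n k)"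
    unfolding set_integrable_def box by (rule integrable_lborel_prod_cart[OF g])
  show "(LINT z:grouping_box h|lborel. (\<Prod>k\<in>UNIV. z $ k ^ n k)) =
        (\<Prod>k\<in>UNIV. h k ^ Suc (n k) * (((1/2) ^ Suc (n k) - (- (1/2)) ^ Suc (n k)) / real (Suc (n k))))"
    unfolding set_lebesgue_integral_def box integral_lborel_prod_cart[OF g]
    unfolding g_def by (simp only: integral_power_Ioo[OF h])
qed

section \<open>Comparing both sides\<close>

lemma prod_binomial:
  fixes a b :: "'n::finite \<Rightarrow> 'c::comm_semiring_1"
  shows "(\<Prod>k\<in>UNIV. (a k + b k) ^ t k) =
    (\<Sum>s\<in>PiE UNIV (\<lambda>k. {..t k}).
      of_nat (\<Prod>k\<in>UNIV. t k choose s k) * ((\<Prod>k\<in>UNIV. a k ^ s k) * (\<Prod>k\<in>UNIV. b k ^ (t k - s k))))"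
  by (simp add: binomial_ring prod_sum_PiE prod.distrib mult.assoc)

text \<open>Finiteness of the moments is given on the probability space; the expansion of the grouped moment
  needs it as integrability against the density.\<close>

lemma integrable_raw_moment:
  fixes X :: "'w \<Rightarrow> real ^ 'n"
  assumes f: "\<And>x. f x \<ge> 0"
    and X: "distributed P lborel X (\<lambda>x. ennreal (f x))"
    and abs: "integrable P (\<lambda>\<omega>. \<Prod>k\<in>UNIV. \<bar>X \<omega> $ k\<bar> ^ t k)"
  shows "integrable lborel (\<lambda>x. (\<Prod>k\<in>UNIV. x $ k ^ t k) * f x)"
proof -
  have X_meas [measurable]: "X \<in> borel_measurable P"
    using distributed_measurable[OF X] by simp
  note borel_measurable_nth [measurable]
  have "integrable P (\<lambda>\<omega>. \<Prod>k\<in>UNIV. X \<omega> $ k ^ t k)"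
    by (rule Bochner_Integration.integrable_bound[OF abs]) (auto simp: abs_prod power_abs)
  then have "integrable lborel (\<lambda>x. f x * (\<Prod>k\<in>UNIV. x $ k ^ t k))"
    by (subst distributed_integrable[OF X]) (use f in auto)
  then show ?thesis
    by (simp add: mult.commute)
qed

text \<open>Both integrals may be exchanged with the finite binomial sum because every term is integrable. One
  factor \<open>h\<^sub>k\<close> of each one-dimensional integral cancels against the volume of the box in the
  normalisation.\<close>

lemma grouped_moment_expansion:
  fixes f :: "real ^ 'n \<Rightarrow> real"
  assumes int: "\<And>s. integrable lborel (\<lambda>x. (\<Prod>k\<in>UNIV. x $ k ^ s k) * f x)"
    and h: "\<And>k. h k > 0"
  shows "grouped_moment h f t =
    (\<Sum>s\<in>PiE UNIV (\<lambda>k. {..t k}). of_nat (\<Prod>k\<in>UNIV. t k choose s k) * (raw_moment f s *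
      (\<Prod>k\<in>UNIV. h k ^ (t k - s k) *
        (((1/2) ^ Suc (t k - s k) - (- (1/2)) ^ Suc (t k - s k)) / real (Suc (t k - s k))))))"
proof -
  let ?S = "PiE UNIV (\<lambda>k. {..t k})" and ?c = "\<lambda>s. real (\<Prod>k\<in>UNIV. t k choose s k)"
  let ?m = "\<lambda>n. ((1/2) ^ Suc n - (- (1/2)) ^ Suc n) / real (Suc n)"
  have inner: "(LINT x|lborel. (\<Prod>k\<in>UNIV. (x $ k + z $ k) ^ t k) * f x) =
      (\<Sum>s\<in>?S. (?c s * raw_moment f s) * (\<Prod>k\<in>UNIV. z $ k ^ (t k - s k)))" for z
  proof -
    have "(LINT x|lborel. (\<Prod>k\<in>UNIV. (x $ k + z $ k) ^ t k) * f x) =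
      (LINT x|lborel. (\<Sum>s\<in>?S. (?c s * (\<Prod>k\<in>UNIV. z $ k ^ (t k - s k))) *
         ((\<Prod>k\<in>UNIV. x $ k ^ s k) * f x)))"
      by (simp only: prod_binomial sum_distrib_right mult.assoc mult.left_commute)
    also have "\<dots> = (\<Sum>s\<in>?S. (?c s * (\<Prod>k\<in>UNIV. z $ k ^ (t k - s k))) * raw_moment f s)"
      unfolding raw_moment_def
      by (subst Bochner_Integration.integral_sum)
        (auto simp only: integral_mult_right_zero intro!: integrable_mult_right int)
    finally show ?thesis
      by (simp only: mult_ac)
  qed
  have pull_out: "(\<Prod>k\<in>UNIV. h k ^ Suc (n k) * M k) = (\<Prod>k\<in>UNIV. h k) * (\<Prod>k\<in>UNIV. h k ^ n k * M k)"
    for n and M :: "'n \<Rightarrow> real"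
    by (simp add: prod.distrib mult.assoc)
  have "(LINT z:grouping_box h|lborel. (LINT x|lborel. (\<Prod>k\<in>UNIV. (x $ k + z $ k) ^ t k) * f x)) =
      (\<Sum>s\<in>?S. (?c s * raw_moment f s) * (\<Prod>k\<in>UNIV. h k ^ Suc (t k - s k) * ?m (t k - s k)))"
    unfolding inner set_lebesgue_integral_def scaleR_sum_right
  proof (subst Bochner_Integration.integral_sum)
    show "integrable lborel (\<lambda>z. indicator (grouping_box h) z *\<^sub>R
        ((?c s * raw_moment f s) * (\<Prod>k\<in>UNIV. z $ k ^ (t k - s k))))" for s
      using set_integrable_mult_right[OF set_integrable_grouping_box[of h "\<lambda>k. t k - s k", OF h]]
      unfolding set_integrable_def .
    have "(LINT z:grouping_box h|lborel. (?c s * raw_moment f s) * (\<Prod>k\<in>UNIV. z $ k ^ (t k - s k))) =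
        (?c s * raw_moment f s) * (\<Prod>k\<in>UNIV. h k ^ Suc (t k - s k) * ?m (t k - s k))" for s
      by (simp only: set_integral_mult_right set_integral_grouping_box[of h "\<lambda>k. t k - s k", OF h])
    then show "(\<Sum>s\<in>?S. LINT z|lborel. indicator (grouping_box h) z *\<^sub>R
          ((?c s * raw_moment f s) * (\<Prod>k\<in>UNIV. z $ k ^ (t k - s k)))) =
        (\<Sum>s\<in>?S. (?c s * raw_moment f s) * (\<Prod>k\<in>UNIV. h k ^ Suc (t k - s k) * ?m (t k - s k)))"
      unfolding set_lebesgue_integral_def by simp
  qed
  also have "\<dots> = (\<Prod>k\<in>UNIV. h k) *
      (\<Sum>s\<in>?S. ?c s * (raw_moment f s * (\<Prod>k\<in>UNIV. h k ^ (t k - s k) * ?m (t k - s k))))"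
    unfolding pull_out sum_distrib_left by (intro sum.cong refl) (simp only: mult_ac)
  finally show ?thesis
    using h by (simp add: grouped_moment_def less_imp_neq[symmetric])
qed

context umbral_calculus
begin

text \<open>The umbral counterpart of \<open>grouped_moment_expansion\<close>, with the same shape of summands. The
  \<open>\<mu> k\<close> may be correlated among themselves, so their joint evaluation stays unsplit, like the
  joint raw moments.\<close>

lemma E_prod_shifted_expansion:
  fixes \<mu> :: "'n::finite \<Rightarrow> 'a upoly"
  assumes indep: "\<And>k l. k \<noteq> l \<Longrightarrow> uncorrelated (q k) (q l)"
    and indep_\<mu>: "\<And>k l. uncorrelated (q k) (\<mu> l)"
  shows "E (\<Prod>k\<in>UNIV. (\<mu> k + uconst (h k) * q k) ^ t k) =
    (\<Sum>s\<in>PiE UNIV (\<lambda>k. {..t k}). of_nat (\<Prod>k\<in>UNIV. t k choose s k) * (E (\<Prod>k\<in>UNIV. \<mu> k ^ s k) *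
      (\<Prod>k\<in>UNIV. [:h k ^ (t k - s k):] * E (q k ^ (t k - s k)))))"
proof -
  have power: "(uconst r * p) ^ n = uconst (r ^ n) * p ^ n" for r n and p :: "'a upoly"
    by (induction n) (simp_all add: ucoeff_simps mult_ac flip: one_pCons, simp add: mult_ac flip: ucoeff_simps)
  have supp: "usupp (uconst r * q k ^ n) \<subseteq> usupp (q k)" for r k n
    using usupp_mult[of "uconst r" "q k ^ n"] usupp_power[of "q k" n] by auto
  have q: "E (\<Prod>k\<in>UNIV. (uconst (h k) * q k) ^ n k) = (\<Prod>k\<in>UNIV. [:h k ^ n k:] * E (q k ^ n k))" for n
  proof -
    have "uncorrelated (uconst (h k ^ n k) * q k ^ n k) (uconst (h l ^ n l) * q l ^ n l)"
      if "k \<noteq> l" for k l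
      using indep[OF that] supp[of "h k ^ n k" k "n k"] supp[of "h l ^ n l" l "n l"]
      unfolding uncorrelated_def by blast
    then show ?thesis
      unfolding power by (subst E_prod_uncorrelated) (simp_all add: E_ucoeff_mult)
  qed
  have "uncorrelated (\<Prod>k\<in>UNIV. \<mu> k ^ s k) (\<Prod>k\<in>UNIV. (uconst (h k) * q k) ^ n k)" for s n
  proof -
    have "usupp (\<Prod>k\<in>UNIV. \<mu> k ^ s k) \<subseteq> (\<Union>k. usupp (\<mu> k))"
      by (rule order_trans[OF usupp_prod UN_mono]) (auto intro: usupp_power[THEN subsetD])
    moreover have "usupp (\<Prod>k\<in>UNIV. (uconst (h k) * q k) ^ n k) \<subseteq> (\<Union>k. usupp (q k))"
      unfolding power by (rule order_trans[OF usupp_prod UN_mono]) (auto intro: supp[THEN subsetD])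
    ultimately show ?thesis
      using indep_\<mu> unfolding uncorrelated_def by fast
  qed
  then show ?thesis
    unfolding prod_binomial E_sum E_of_nat_mult by (simp only: E_mult_uncorrelated q)
qed

end

theorem theorem4p1:
  fixes E :: "'a upoly \<Rightarrow> real poly"
    and aug :: 'a
    and P :: "'w measure"
    and X :: "'w \<Rightarrow> real ^ 'n"
    and f :: "real ^ 'n \<Rightarrow> real"
    and h :: "'n \<Rightarrow> real"
    and \<mu> \<mu>' :: "'n \<Rightarrow> 'a upoly"
    and \<iota> neg\<iota> :: "'n \<Rightarrow> 'a"
  assumes "umbral_calculus E aug"
    and "prob_space P"
    and "\<And>x. f x \<ge> 0"
    and "distributed P lborel X (\<lambda>x. ennreal (f x))"
    and "\<And>t :: 'n \<Rightarrow> nat. integrable P (\<lambda>\<omega>. \<Prod>k\<in>UNIV. \<bar>X \<omega> $ k\<bar> ^ t k)"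
    and "\<And>k. h k > 0"
    and "\<And>k. umbral_monomial (\<mu> k)"
    and "\<And>k. umbral_monomial (\<mu>' k)"
    and "\<And>t. E (\<Prod>k\<in>UNIV. \<mu> k ^ t k) = [:raw_moment f t:]"
    and "\<And>t. E (\<Prod>k\<in>UNIV. \<mu>' k ^ t k) = [:grouped_moment h f t:]"
    and "\<And>k. bernoulli_umbra E (\<iota> k)"
    and "\<And>k. inverse_umbra E aug (\<iota> k) (neg\<iota> k)"
    and "\<And>k l. k \<noteq> l \<Longrightarrow> uncorrelated (umbra (\<iota> k)) (umbra (\<iota> l))"
    and "\<And>k l. k \<noteq> l \<Longrightarrow> uncorrelated (umbra (neg\<iota> k)) (umbra (neg\<iota> l))"
    and "\<And>k l. uncorrelated (umbra (\<iota> k)) (umbra (neg\<iota> l))"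
    and "\<And>k l. uncorrelated (umbra (\<iota> k)) (\<mu> l)"
    and "\<And>k l. uncorrelated (umbra (neg\<iota> k)) (\<mu> l)"
  shows "\<forall>t :: 'n \<Rightarrow> nat.
    similar E (\<Prod>k\<in>UNIV. \<mu>' k ^ t k)
      (\<Prod>k\<in>UNIV. (\<mu> k + uconst (h k) * (umbra (neg\<iota> k) - uconst (1/2))) ^ t k)"
proof -
  interpret umbral_calculus E aug by fact
  \<comment> \<open>A sum rather than a difference, as needed for the binomial expansion.\<close>
  define q where "q k = umbra (neg\<iota> k) + uconst (- (1/2))" for k
  have q_eq: "umbra (neg\<iota> k) - uconst (1/2) = q k" for k
    by (simp add: q_def flip: ucoeff_simps)
  have q_supp: "usupp (q k) \<subseteq> usupp (umbra (neg\<iota> k))" for k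
    using usupp_add[of "umbra (neg\<iota> k)" "uconst (- (1/2))"] by (simp add: q_def)
  have indep: "uncorrelated (q k) (q l)" if "k \<noteq> l" for k l
    using assms(14)[OF that] q_supp[of k] q_supp[of l] unfolding uncorrelated_def by blast
  have indep_\<mu>: "uncorrelated (q k) (\<mu> l)" for k l
    using assms(17)[of k l] q_supp[of k] unfolding uncorrelated_def by blast
  have moment: "E (q k ^ n) = [:((1/2) ^ Suc n - (- (1/2)) ^ Suc n) / real (Suc n):]" for k n
    unfolding q_def shifted_inverse_bernoulli_moment[OF assms(11,12)] by simp
  have const_prod: "(\<Prod>k\<in>UNIV. [:c k:] * [:d k:]) = [:\<Prod>k\<in>UNIV. c k * d k:]" for c d :: "'n \<Rightarrow> real"
    by (simp add: prod_to_poly mult.commute)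
  have const_term: "of_nat m * ([:c:] * [:d:]) = [:real m * (c * d):]" for m c d
    by (simp add: of_nat_poly)
  have eq: "E (\<Prod>k\<in>UNIV. \<mu>' k ^ t k) = E (\<Prod>k\<in>UNIV. (\<mu> k + uconst (h k) * q k) ^ t k)" for t
  proof -
    have "E (\<Prod>k\<in>UNIV. (\<mu> k + uconst (h k) * q k) ^ t k) = [:grouped_moment h f t:]"
      unfolding grouped_moment_expansion[OF integrable_raw_moment[OF assms(3-5)] assms(6)]
      by (subst E_prod_shifted_expansion)
        (simp_all only: indep indep_\<mu> moment assms(9) const_prod const_term sum_to_poly not_False_eq_True)
    then show ?thesis
      by (simp only: assms(10))
  qed
  have power: "(\<Prod>k\<in>UNIV. p k ^ t k) ^ n = (\<Prod>k\<in>UNIV. p k ^ (t k * n))"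
    for p :: "'n \<Rightarrow> 'a upoly" and t n
    by (simp only: prod_power_distrib power_mult)
  show ?thesis
    unfolding similar_def umbrally_equiv_def q_eq power
    by (intro allI eq)
qed

end
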